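(* Let $G$ be a finite group, $N\trianglelefteq G$ a normal subgroup, $p\colon G\twoheadrightarrow G/N$ the projection, and $\mathcal{O},\mathcal{O}_m$ a pair of $G/N$-transfer systems. Then: (1) If $\mathcal{O}$ is disklike, then so is $p^*\mathcal{O}$. (2) If $\mathcal{O}$ is saturated, then so is $p^*\mathcal{O}$. (3) If $(\mathcal{O},\mathcal{O}_m)$ is compatible, then so is $(p^*\mathcal{O},p^*\mathcal{O}_m)$. (4) If $(\mathcal{O},\mathcal{O}_m)$ is maximally compatible, then so is $(p^*\mathcal{O},p^*\mathcal{O}_m)$.
   Context: For a finite group $G$, a $G$-transfer system $\mathcal{O}$ is a binary relation $\to$ on the set of subgroups of $G$, refining inclusion ($K\to H$ implies $K\le H$), such that: $H\to H$ for all $H\le G$; $K\to H$ implies $gKg^{-1}\to gHg^{-1}$ for all $g\in G$; $K\to H$ and $L\le H$ imply $K\cap L\to L$; and $L\to K$, $K\to H$ imply $L\to H$. Its elements are called transfers. The transfer system $T(B)$ generated by a binary relation $B$ refining inclusion is the intersection of all $G$-transfer systems containing $B$. $\mathcal{O}$ is disklike if it is generated by a set of transfers all with target $G$. $\mathcal{O}$ is saturated if whenever $L\le K\le H\le G$ and $L\to H$ is in $\mathcal{O}$, then $K\to H$ is in $\mathcal{O}$. A pair $(\mathcal{O}_a,\mathcal{O}_m)$ of $G$-transfer systems is compatible if $\mathcal{O}_m\subseteq\mathcal{O}_a$ and, for all $K,J\le H\le G$, if $K\to H$ is in $\mathcal{O}_m$ and $K\cap J\to K$ is in $\mathcal{O}_a$,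 then $J\to H$ is in $\mathcal{O}_a$. For every $\mathcal{O}$ there is a unique largest (under containment) transfer system $\mathrm{M}(\mathcal{O})$ such that $(\mathcal{O},\mathrm{M}(\mathcal{O}))$ is compatible; $(\mathcal{O},\mathcal{O}_m)$ is maximally compatible if $\mathcal{O}_m=\mathrm{M}(\mathcal{O})$. Inflation: for a $G/N$-transfer system $\mathcal{O}$, let $p^{-1}\mathcal{O}=\{p^{-1}K\to p^{-1}H \mid K\to H\text{ in }\mathcal{O}\}$, and let $p^*\mathcal{O}=T(p^{-1}\mathcal{O})$, a $G$-transfer system. *)

theory Defs
  imports "HOL-Algebra.Coset"
begin

definition transfer_system :: "('a, 'b) monoid_scheme \<Rightarrow> ('a set \<times> 'a set) set \<Rightarrow> bool" where
  "transfer_system G R \<longleftrightarrow>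
     (\<forall>K H. (K, H) \<in> R \<longrightarrow> subgroup K G \<and> subgroup H G \<and> K \<subseteq> H) \<and>
     (\<forall>H. subgroup H G \<longrightarrow> (H, H) \<in> R) \<and>
     (\<forall>K H. \<forall>g \<in> carrier G. (K, H) \<in> R \<longrightarrow>
        (g <#\<^bsub>G\<^esub> K #>\<^bsub>G\<^esub> inv\<^bsub>G\<^esub> g, g <#\<^bsub>G\<^esub> H #>\<^bsub>G\<^esub> inv\<^bsub>G\<^esub> g) \<in> R) \<and>
     (\<forall>K H L. (K, H) \<in> R \<longrightarrow> subgroup L G \<longrightarrow> L \<subseteq> H \<longrightarrow> (K \<inter> L, L) \<in> R) \<and>
     (\<forall>L K H. (L, K) \<in> R \<longrightarrow> (K, H) \<in> R \<longrightarrow> (L, H) \<in> R)"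

text \<open>Only meaningful when \<open>B\<close> relates subgroups of \<open>G\<close> and refines inclusion; otherwise the
  intersection is over the empty family.\<close>

definition generated_transfer_system ::
  "('a, 'b) monoid_scheme \<Rightarrow> ('a set \<times> 'a set) set \<Rightarrow> ('a set \<times> 'a set) set" where
  "generated_transfer_system G B = \<Inter> {R. transfer_system G R \<and> B \<subseteq> R}"

definition disklike :: "('a, 'b) monoid_scheme \<Rightarrow> ('a set \<times> 'a set) set \<Rightarrow> bool" where
  "disklike G R \<longleftrightarrow> transfer_system G R \<and>
     (\<exists>B. B \<subseteq> {K. subgroup K G} \<times> {carrier G} \<and> R = generated_transfer_system G B)"

definition saturated :: "('a, 'b) monoid_scheme \<Rightarrow> ('a set \<times> 'a set) set \<Rightarrow> bool" where
  "saturated G R \<longleftrightarrow> transfer_system G R \<and>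
     (\<forall>L K H. (L, H) \<in> R \<longrightarrow> subgroup K G \<longrightarrow> L \<subseteq> K \<longrightarrow> K \<subseteq> H \<longrightarrow> (K, H) \<in> R)"

definition compatible ::
  "('a, 'b) monoid_scheme \<Rightarrow> ('a set \<times> 'a set) set \<Rightarrow> ('a set \<times> 'a set) set \<Rightarrow> bool" where
  "compatible G Ra Rm \<longleftrightarrow> transfer_system G Ra \<and> transfer_system G Rm \<and> Rm \<subseteq> Ra \<and>
     (\<forall>K J H. (K, H) \<in> Rm \<longrightarrow> subgroup J G \<longrightarrow> J \<subseteq> H \<longrightarrow> (K \<inter> J, K) \<in> Ra \<longrightarrow> (J, H) \<in> Ra)"

text \<open>The greatest element is taken with respect to inclusion of relations; the lemmas at the end
  show that it exists.\<close>

definition max_compatible ::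
  "('a, 'b) monoid_scheme \<Rightarrow> ('a set \<times> 'a set) set \<Rightarrow> ('a set \<times> 'a set) set" where
  "max_compatible G R = (GREATEST Rm. compatible G R Rm)"

definition maximally_compatible ::
  "('a, 'b) monoid_scheme \<Rightarrow> ('a set \<times> 'a set) set \<Rightarrow> ('a set \<times> 'a set) set \<Rightarrow> bool" where
  "maximally_compatible G R Rm \<longleftrightarrow> compatible G R Rm \<and> Rm = max_compatible G R"

text \<open>The projection \<open>G \<rightarrow> G Mod N\<close> sends \<open>g\<close> to the right coset of \<open>N\<close> containing \<open>g\<close>.\<close>

definition quotient_preimage :: "('a, 'b) monoid_scheme \<Rightarrow> 'a set \<Rightarrow> 'a set set \<Rightarrow> 'a set" where
  "quotient_preimage G N K = {g \<in> carrier G. N #>\<^bsub>G\<^esub> g \<in> K}"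

definition inflation ::
  "('a, 'b) monoid_scheme \<Rightarrow> 'a set \<Rightarrow> ('a set set \<times> 'a set set) set \<Rightarrow> ('a set \<times> 'a set) set" where
  "inflation G N R = generated_transfer_system G
     {(quotient_preimage G N K, quotient_preimage G N H) | K H. (K, H) \<in> R}"

lemma exists_largest_compatible:
  assumes G: "group G" and R: "transfer_system G R"
  shows "\<exists>M. compatible G R M \<and> (\<forall>M'. compatible G R M' \<longrightarrow> M' \<subseteq> M)"
proof -
  interpret group G by fact
  define c where "c g A = g <#\<^bsub>G\<^esub> A #>\<^bsub>G\<^esub> inv\<^bsub>G\<^esub> g" for g A
  have c_image: "c g A = (\<lambda>x. g \<otimes>\<^bsub>G\<^esub> x \<otimes>\<^bsub>G\<^esub> inv\<^bsub>G\<^esub> g) ` A" for g A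
    by (auto simp: c_def l_coset_def r_coset_def)
  have c_mono: "c g A \<subseteq> c g B" if "A \<subseteq> B" for g A B
    using that by (auto simp: c_image)
  have c_inj: "inj_on (\<lambda>x. g \<otimes>\<^bsub>G\<^esub> x \<otimes>\<^bsub>G\<^esub> inv\<^bsub>G\<^esub> g) (carrier G)" if "g \<in> carrier G" for g
    using that by (auto simp: inj_on_def)
  have c_Int: "c g (A \<inter> B) = c g A \<inter> c g B"
    if "g \<in> carrier G" "A \<subseteq> carrier G" "B \<subseteq> carrier G" for g A B
    using that inj_on_image_Int[OF c_inj] by (simp add: c_image)
  have c_inv: "c g (c (inv\<^bsub>G\<^esub> g) A) = A" "c (inv\<^bsub>G\<^esub> g) (c g A) = A"
    if "g \<in> carrier G" "A \<subseteq> carrier G" for g A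
  proof -
    have "g \<otimes>\<^bsub>G\<^esub> (inv\<^bsub>G\<^esub> g \<otimes>\<^bsub>G\<^esub> x \<otimes>\<^bsub>G\<^esub> g) \<otimes>\<^bsub>G\<^esub> inv\<^bsub>G\<^esub> g = x"
      "inv\<^bsub>G\<^esub> g \<otimes>\<^bsub>G\<^esub> (g \<otimes>\<^bsub>G\<^esub> x \<otimes>\<^bsub>G\<^esub> inv\<^bsub>G\<^esub> g) \<otimes>\<^bsub>G\<^esub> g = x" if "x \<in> A" for x
      using that \<open>g \<in> carrier G\<close> \<open>A \<subseteq> carrier G\<close>
      by (auto simp: m_assoc[symmetric] subset_iff) (auto simp: m_assoc)
    then show "c g (c (inv\<^bsub>G\<^esub> g) A) = A" "c (inv\<^bsub>G\<^esub> g) (c g A) = A"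
      using that by (simp_all add: c_image image_image)
  qed
  have sub: "subgroup K G" "subgroup H G" "K \<subseteq> H" if "(K, H) \<in> R" for K H
    using R that by (auto simp: transfer_system_def)
  have refl: "(H, H) \<in> R" if "subgroup H G" for H
    using R that by (auto simp: transfer_system_def)
  have cnj: "(c g K, c g H) \<in> R" if "(K, H) \<in> R" "g \<in> carrier G" for g K H
    using R that by (auto simp: transfer_system_def c_def)
  have trans: "(L, H) \<in> R" if "(L, K) \<in> R" "(K, H) \<in> R" for L K H
    using R that unfolding transfer_system_def by blast
  have c_sub: "subgroup (c g H) G" if "subgroup H G" "g \<in> carrier G" for g H
    using cnj[OF refl] sub that by blast
  define P where "P K L \<longleftrightarrow> (\<forall>J. subgroup J G \<longrightarrow> J \<subseteq> L \<longrightarrow> (K \<inter> L \<inter> J, K \<inter> L) \<in> R \<longrightarrow> (J, L) \<in> R)"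
    for K L
  define M where "M = {(K, H). (K, H) \<in> R \<and> (\<forall>L. subgroup L G \<longrightarrow> L \<subseteq> H \<longrightarrow> P K L)}"
  have M_trans: "transfer_system G M"
    unfolding transfer_system_def
  proof (intro conjI allI impI ballI)
    fix K H assume "(K, H) \<in> M"
    then show "subgroup K G" "subgroup H G" "K \<subseteq> H" using sub by (auto simp: M_def)
  next
    fix H assume H: "subgroup H G"
    have "P H L" if "L \<subseteq> H" for L
      using that by (auto simp: P_def Int_absorb1 Int_absorb2)
    then show "(H, H) \<in> M" using refl[OF H] by (auto simp: M_def)
  next
    fix K H g assume g: "g \<in> carrier G" and KH: "(K, H) \<in> M"
    have KHR: "(K, H) \<in> R" using KH by (simp add: M_def)
    have Kc: "K \<subseteq> carrier G" and Hc: "H \<subseteq> carrier G"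
      using sub[OF KHR] by (auto dest: subgroup.subset)
    have "P (c g K) L" if L: "subgroup L G" "L \<subseteq> c g H" for L
      unfolding P_def
    proof (intro allI impI)
      fix J assume J: "subgroup J G" "J \<subseteq> L" "(c g K \<inter> L \<inter> J, c g K \<inter> L) \<in> R"
      let ?i = "inv\<^bsub>G\<^esub> g"
      have i: "?i \<in> carrier G" using g by simp
      have Lc: "L \<subseteq> carrier G" and Jc: "J \<subseteq> carrier G" and cKc: "c g K \<subseteq> carrier G"
        using L J c_sub[OF sub(1)[OF KHR] g] by (auto dest: subgroup.subset)
      have "(c ?i (c g K \<inter> L \<inter> J), c ?i (c g K \<inter> L)) \<in> R" using cnj[OF J(3) i] .
      then have "(K \<inter> c ?i L \<inter> c ?i J, K \<inter> c ?i L) \<in> R"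
        using i g Lc Jc cKc Kc by (simp add: c_Int c_inv le_infI1)
      moreover have "c ?i L \<subseteq> H" using c_mono[OF L(2), of ?i] c_inv(2)[OF g Hc] by simp
      moreover have "c ?i J \<subseteq> c ?i L" using c_mono J(2) by simp
      ultimately have "(c ?i J, c ?i L) \<in> R"
        using KH c_sub[OF L(1) i] c_sub[OF J(1) i] by (simp add: M_def P_def)
      from cnj[OF this g] show "(J, L) \<in> R" using c_inv(1) g Lc Jc by simp
    qed
    then show "(g <#\<^bsub>G\<^esub> K #>\<^bsub>G\<^esub> inv\<^bsub>G\<^esub> g, g <#\<^bsub>G\<^esub> H #>\<^bsub>G\<^esub> inv\<^bsub>G\<^esub> g) \<in> M"
      using cnj[OF KHR g] by (simp add: M_def c_def)
  next
    fix K H L assume KH: "(K, H) \<in> M" and L: "subgroup L G" "L \<subseteq> H"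
    have "(K, H) \<in> R" using KH by (simp add: M_def)
    then have "(K \<inter> L, L) \<in> R" using R L unfolding transfer_system_def by blast
    moreover have "P (K \<inter> L) L'" if "subgroup L' G" "L' \<subseteq> L" for L'
    proof -
      have "P K L'" using KH that L by (auto simp: M_def)
      moreover have "K \<inter> L \<inter> L' = K \<inter> L'" using that by blast
      ultimately show ?thesis by (simp add: P_def)
    qed
    ultimately show "(K \<inter> L, L) \<in> M" by (simp add: M_def)
  next
    fix L K H assume LK: "(L, K) \<in> M" and KH: "(K, H) \<in> M"
    have "P L Q" if Q: "subgroup Q G" "Q \<subseteq> H" for Q
      unfolding P_def
    proof (intro allI impI)
      fix J assume J: "subgroup J G" "J \<subseteq> Q" "(L \<inter> Q \<inter> J, L \<inter> Q) \<in> R"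
      have K: "subgroup K G" and "L \<subseteq> K" using LK sub by (auto simp: M_def)
      have "subgroup (K \<inter> Q) G" "subgroup (K \<inter> Q \<inter> J) G"
        using K Q J by (simp_all add: subgroups_Inter_pair)
      moreover have "L \<inter> (K \<inter> Q) \<inter> (K \<inter> Q \<inter> J) = L \<inter> Q \<inter> J" "L \<inter> (K \<inter> Q) = L \<inter> Q"
        using \<open>L \<subseteq> K\<close> by auto
      moreover have "P L (K \<inter> Q)" using LK \<open>subgroup (K \<inter> Q) G\<close> by (auto simp: M_def)
      ultimately have "(K \<inter> Q \<inter> J, K \<inter> Q) \<in> R" using J(3) unfolding P_def by (metis Int_lower1)
      moreover have "P K Q" using KH Q by (auto simp: M_def)
      ultimately show "(J, Q) \<in> R" using J by (simp add: P_def)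
    qed
    moreover have "(L, H) \<in> R" using trans LK KH by (auto simp: M_def)
    ultimately show "(L, H) \<in> M" by (simp add: M_def)
  qed
  have "(J, H) \<in> R"
    if "(K, H) \<in> M" "subgroup J G" "J \<subseteq> H" "(K \<inter> J, K) \<in> R" for K J H
  proof -
    have KH: "(K, H) \<in> R" using that(1) by (simp add: M_def)
    then have "P K H" "K \<inter> H = K" using that(1) sub[OF KH] by (auto simp: M_def)
    then show ?thesis using that by (simp add: P_def)
  qed
  then have "compatible G R M"
    using R M_trans unfolding compatible_def by (auto simp: M_def)
  moreover have "M' \<subseteq> M" if M': "compatible G R M'" for M'
  proof clarify
    fix K H assume KH: "(K, H) \<in> M'"
    have "P K L" if L: "subgroup L G" "L \<subseteq> H" for L
    proof -
      have "(K \<inter> L, L) \<in> M'"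
        using M' KH L unfolding compatible_def transfer_system_def by blast
      then have "\<And>J. subgroup J G \<Longrightarrow> J \<subseteq> L \<Longrightarrow> (K \<inter> L \<inter> J, K \<inter> L) \<in> R \<Longrightarrow> (J, L) \<in> R"
        using M' unfolding compatible_def by blast
      then show ?thesis by (simp add: P_def)
    qed
    moreover have "(K, H) \<in> R" using M' KH by (auto simp: compatible_def)
    ultimately show "(K, H) \<in> M" by (simp add: M_def)
  qed
  ultimately show ?thesis by blast
qed

lemma
  assumes "group G" and "transfer_system G R"
  shows compatible_max_compatible: "compatible G R (max_compatible G R)"
    and max_compatible_greatest: "compatible G R Rm \<Longrightarrow> Rm \<subseteq> max_compatible G R"
proof -
  obtain M where "compatible G R M" "\<And>M'. compatible G R M' \<Longrightarrow> M' \<subseteq> M"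
    using exists_largest_compatible[OF assms] by blast
  moreover from this have "max_compatible G R = M"
    unfolding max_compatible_def by (intro Greatest_equality) auto
  ultimately show "compatible G R (max_compatible G R)"
    "compatible G R Rm \<Longrightarrow> Rm \<subseteq> max_compatible G R" by auto
qed

end

theory Submission
  imports Defs
begin

text \<open>
  Everything follows from an explicit description of the inflated transfer system. Let
  \<open>p : G \<rightarrow> Q\<close> be a surjective homomorphism and \<open>\<O>\<close> a transfer system on \<open>Q\<close>. Restricting the
  generator \<open>p\<^sup>-\<^sup>1(p K) \<rightarrow> p\<^sup>-\<^sup>1(p H)\<close> to \<open>H\<close> gives \<open>K \<rightarrow> H\<close> as soon as \<open>ker p \<inter> H \<subseteq> K\<close>, and the
  relation of all \<open>K \<subseteq> H\<close> with \<open>ker p \<inter> H \<subseteq> K\<close> and \<open>p K \<rightarrow> p H\<close> in \<open>\<O>\<close> already satisfies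
  all the axioms. Hence this relation, called \<open>pullback\<close> below, is the inflation
  (\<open>generated_preimage_relation\<close>). The kernel condition is what makes \<open>p\<close> compatible with
  intersections: \<open>p (K \<inter> L) = p K \<inter> p L\<close> for \<open>L \<subseteq> H\<close> (\<open>image_Int\<close>), an equation that fails for
  arbitrary subgroups. Saturation and compatibility can then be read off from the images under \<open>p\<close>.

  For disklikeness, let \<open>B\<close> generate \<open>\<O>\<close>. For any transfer system \<open>T\<close> on \<open>G\<close>, the pairs of
  subgroups of \<open>Q\<close> whose preimages are related by \<open>T\<close> form a transfer system
  (\<open>transfer_system_pushforward\<close>); if \<open>T\<close> contains \<open>p\<^sup>-\<^sup>1 B\<close>, this one contains \<open>B\<close>, hence \<open>\<O>\<close>.
  So \<open>p\<^sup>-\<^sup>1 B\<close> generates the inflation, and its targets are \<open>p\<^sup>-\<^sup>1 Q = G\<close>.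

  For maximality, let \<open>T\<close> be compatible with the inflation of \<open>\<O>\<close>. Every transfer of \<open>T\<close> satisfies
  the kernel condition, so it suffices to see that its image lies in \<open>M(\<O>)\<close>. The image of \<open>T\<close> need
  not be transitive, since different subgroups of \<open>G\<close> may have the same image; but its transitive
  closure is a transfer system compatible with \<open>\<O>\<close> (\<open>compatible_image\<close>), because restriction and
  the compatibility condition pass to compositions.
\<close>

section \<open>Transfer systems and transitive closures\<close>

definition preimage_relation ::
  "('a, 'c) monoid_scheme \<Rightarrow> ('a \<Rightarrow> 'b) \<Rightarrow> ('b set \<times> 'b set) set \<Rightarrow> ('a set \<times> 'a set) set" where
  "preimage_relation G h R =
     {({g \<in> carrier G. h g \<in> K}, {g \<in> carrier G. h g \<in> H}) | K H. (K, H) \<in> R}"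

lemma transfer_system_subgroup:
  assumes "transfer_system G R" "(K, H) \<in> R"
  shows "subgroup K G" "subgroup H G" "K \<subseteq> H"
  using assms by (auto simp: transfer_system_def)

lemma transfer_system_refl: "transfer_system G R \<Longrightarrow> subgroup H G \<Longrightarrow> (H, H) \<in> R"
  by (simp add: transfer_system_def)

lemma transfer_system_conj:
  "transfer_system G R \<Longrightarrow> (K, H) \<in> R \<Longrightarrow> g \<in> carrier G \<Longrightarrow>
    (g <#\<^bsub>G\<^esub> K #>\<^bsub>G\<^esub> inv\<^bsub>G\<^esub> g, g <#\<^bsub>G\<^esub> H #>\<^bsub>G\<^esub> inv\<^bsub>G\<^esub> g) \<in> R"
  by (simp add: transfer_system_def)

lemma transfer_system_restrict:
  "transfer_system G R \<Longrightarrow> (K, H) \<in> R \<Longrightarrow> subgroup L G \<Longrightarrow> L \<subseteq> H \<Longrightarrow> (K \<inter> L, L) \<in> R"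
  unfolding transfer_system_def by blast

lemma transfer_system_trans:
  "transfer_system G R \<Longrightarrow> (L, K) \<in> R \<Longrightarrow> (K, H) \<in> R \<Longrightarrow> (L, H) \<in> R"
  unfolding transfer_system_def by blast

lemma compatibleD:
  "compatible G R M \<Longrightarrow> (K, H) \<in> M \<Longrightarrow> subgroup J G \<Longrightarrow> J \<subseteq> H \<Longrightarrow> (K \<inter> J, K) \<in> R \<Longrightarrow>
    (J, H) \<in> R"
  by (simp add: compatible_def)

lemma generated_transfer_system_least:
  "transfer_system G R \<Longrightarrow> B \<subseteq> R \<Longrightarrow> generated_transfer_system G B \<subseteq> R"
  by (auto simp: generated_transfer_system_def)

lemma generated_transfer_system_eqI:
  assumes "transfer_system G R" "B \<subseteq> R" "\<And>T. transfer_system G T \<Longrightarrow> B \<subseteq> T \<Longrightarrow> R \<subseteq> T"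
  shows "generated_transfer_system G B = R"
  using assms unfolding generated_transfer_system_def by blast

lemma (in group) conjugate_cancel:
  assumes "g \<in> carrier G" "x \<in> carrier G"
  shows "inv g \<otimes> (g \<otimes> x \<otimes> inv g) \<otimes> g = x"
    and "g \<otimes> (inv g \<otimes> x \<otimes> g) \<otimes> inv g = x"
proof -
  have "inv g \<otimes> (g \<otimes> x \<otimes> inv g) \<otimes> g = (inv g \<otimes> g) \<otimes> x \<otimes> (inv g \<otimes> g)"
    using assms by (simp only: m_assoc m_closed inv_closed)
  then show "inv g \<otimes> (g \<otimes> x \<otimes> inv g) \<otimes> g = x" using assms by simp
  have "g \<otimes> (inv g \<otimes> x \<otimes> g) \<otimes> inv g = (g \<otimes> inv g) \<otimes> x \<otimes> (g \<otimes> inv g)"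
    using assms by (simp only: m_assoc m_closed inv_closed)
  then show "g \<otimes> (inv g \<otimes> x \<otimes> g) \<otimes> inv g = x" using assms by simp
qed

lemma conjugate_eq_image:
  "g <#\<^bsub>G\<^esub> A #>\<^bsub>G\<^esub> inv\<^bsub>G\<^esub> g = (\<lambda>x. g \<otimes>\<^bsub>G\<^esub> x \<otimes>\<^bsub>G\<^esub> inv\<^bsub>G\<^esub> g) ` A"
  by (auto simp: l_coset_def r_coset_def)

lemma conjugate_subgroup:
  assumes "group G" "subgroup H G" "g \<in> carrier G"
  shows "subgroup (g <#\<^bsub>G\<^esub> H #>\<^bsub>G\<^esub> inv\<^bsub>G\<^esub> g) G"
proof -
  interpret group G by fact
  interpret subgroup H G by fact
  let ?c = "\<lambda>x. g \<otimes>\<^bsub>G\<^esub> x \<otimes>\<^bsub>G\<^esub> inv\<^bsub>G\<^esub> g"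
  have m: "?c x \<otimes>\<^bsub>G\<^esub> ?c y = ?c (x \<otimes>\<^bsub>G\<^esub> y)" if "x \<in> carrier G" "y \<in> carrier G" for x y
    using that assms(3) by (simp add: m_assoc) (simp add: m_assoc[symmetric])
  interpret c: group_hom G G ?c
    using m assms(3) by unfold_locales (auto simp: hom_def)
  show ?thesis
    using c.subgroup_img_is_subgroup[OF assms(2)] by (simp add: conjugate_eq_image)
qed

text \<open>
  A composite \<open>K \<rightarrow> H \<rightarrow> H'\<close> restricts to \<open>L \<subseteq> H'\<close> in two steps: the second factor restricts to
  \<open>H \<inter> L \<rightarrow> L\<close>, and the first one, restricted to \<open>H \<inter> L\<close>, starts at \<open>K \<inter> L\<close> because \<open>K \<subseteq> H\<close>.
\<close>

lemma transfer_system_trancl: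
  assumes G: "group G"
    and sub: "\<And>K H. (K, H) \<in> S \<Longrightarrow> subgroup K G \<and> subgroup H G \<and> K \<subseteq> H"
    and refl: "\<And>H. subgroup H G \<Longrightarrow> (H, H) \<in> S"
    and conj: "\<And>K H g. (K, H) \<in> S \<Longrightarrow> g \<in> carrier G \<Longrightarrow>
        (g <#\<^bsub>G\<^esub> K #>\<^bsub>G\<^esub> inv\<^bsub>G\<^esub> g, g <#\<^bsub>G\<^esub> H #>\<^bsub>G\<^esub> inv\<^bsub>G\<^esub> g) \<in> S"
    and res: "\<And>K H L. (K, H) \<in> S \<Longrightarrow> subgroup L G \<Longrightarrow> L \<subseteq> H \<Longrightarrow> (K \<inter> L, L) \<in> S"
  shows "transfer_system G (S\<^sup>+)"
proof -
  interpret group G by fact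
  have sub': "subgroup K G \<and> subgroup H G \<and> K \<subseteq> H" if "(K, H) \<in> S\<^sup>+" for K H
    using that by induction (use sub in blast)+
  show ?thesis
    unfolding transfer_system_def
  proof (intro conjI allI impI ballI)
    fix K H assume "(K, H) \<in> S\<^sup>+"
    then show "subgroup K G" "subgroup H G" "K \<subseteq> H" using sub' by auto
  next
    fix H assume "subgroup H G"
    then show "(H, H) \<in> S\<^sup>+" using refl by blast
  next
    fix K H g assume g: "g \<in> carrier G" and "(K, H) \<in> S\<^sup>+"
    from this(2) show "(g <#\<^bsub>G\<^esub> K #>\<^bsub>G\<^esub> inv\<^bsub>G\<^esub> g, g <#\<^bsub>G\<^esub> H #>\<^bsub>G\<^esub> inv\<^bsub>G\<^esub> g) \<in> S\<^sup>+"
      by induction (use conj g in \<open>blast intro: trancl_into_trancl\<close>)+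
  next
    fix K H L assume "(K, H) \<in> S\<^sup>+" "subgroup L G" "L \<subseteq> H"
    then show "(K \<inter> L, L) \<in> S\<^sup>+"
    proof (induction arbitrary: L)
      case (base H)
      then show ?case using res by blast
    next
      case (step H H')
      have "subgroup H G" "(H \<inter> L, L) \<in> S" using step sub res by blast+
      moreover from this have "(K \<inter> (H \<inter> L), H \<inter> L) \<in> S\<^sup>+"
        using step subgroups_Inter_pair by blast
      moreover have "K \<inter> (H \<inter> L) = K \<inter> L" using sub' step.hyps(1) by blast
      ultimately show ?case by (metis trancl_into_trancl)
    qed
  next
    fix L K H assume "(L, K) \<in> S\<^sup>+" "(K, H) \<in> S\<^sup>+"
    then show "(L, H) \<in> S\<^sup>+" by simp
  qed
qed

text \<open>
  The compatibility condition propagates along a composite \<open>K \<rightarrow> H \<rightarrow> H'\<close>: if \<open>K \<inter> J \<rightarrow> K\<close> is in \<open>R\<close>, then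
  the first factor gives \<open>H \<inter> J \<rightarrow> H\<close>, which is the hypothesis that the second factor needs.
\<close>

lemma compatible_trancl:
  assumes G: "group G" and R: "transfer_system G R" and S: "transfer_system G (S\<^sup>+)"
    and SR: "S \<subseteq> R"
    and comp: "\<And>K J H. (K, H) \<in> S \<Longrightarrow> subgroup J G \<Longrightarrow> J \<subseteq> H \<Longrightarrow> (K \<inter> J, K) \<in> R \<Longrightarrow> (J, H) \<in> R"
  shows "compatible G R (S\<^sup>+)"
proof -
  interpret group G by fact
  have "(K, H) \<in> R" if "(K, H) \<in> S\<^sup>+" for K H
    using that
  proof induction
    case (step H H')
    then show ?case using SR transfer_system_trans[OF R step.IH] by blast
  qed (use SR in blast)
  moreover have "(J, H) \<in> R"
    if "(K, H) \<in> S\<^sup>+" "subgroup J G" "J \<subseteq> H" "(K \<inter> J, K) \<in> R" for K J H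
    using that
  proof (induction arbitrary: J)
    case (base H)
    then show ?case using comp by blast
  next
    case (step H H')
    have "subgroup H G" "K \<subseteq> H"
      using transfer_system_subgroup[OF S step.hyps(1)] by auto
    moreover from this have "K \<inter> (H \<inter> J) = K \<inter> J" by blast
    ultimately have "(H \<inter> J, H) \<in> R"
      using step.IH[of "H \<inter> J"] step.prems subgroups_Inter_pair by auto
    then show ?case using comp[OF step.hyps(2) step.prems(1,2)] by simp
  qed
  ultimately show ?thesis using R S by (auto simp: compatible_def)
qed

section \<open>Pullback along a surjective homomorphism\<close>

locale group_epi = group_hom G Q p for G (structure) and Q (structure) and p +
  assumes surj: "p ` carrier G = carrier Q"
begin

abbreviation pre :: "'c set \<Rightarrow> 'a set" where
  "pre K \<equiv> {g \<in> carrier G. p g \<in> K}"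

definition pullback :: "('c set \<times> 'c set) set \<Rightarrow> ('a set \<times> 'a set) set" where
  "pullback R = {(K, H). subgroup K G \<and> subgroup H G \<and> K \<subseteq> H \<and>
     kernel G Q p \<inter> H \<subseteq> K \<and> (p ` K, p ` H) \<in> R}"

lemma pullbackI:
  "subgroup K G \<Longrightarrow> subgroup H G \<Longrightarrow> K \<subseteq> H \<Longrightarrow> kernel G Q p \<inter> H \<subseteq> K \<Longrightarrow>
    (p ` K, p ` H) \<in> R \<Longrightarrow> (K, H) \<in> pullback R"
  by (simp add: pullback_def)

lemma pullbackD:
  assumes "(K, H) \<in> pullback R"
  shows "subgroup K G" "subgroup H G" "K \<subseteq> H" "kernel G Q p \<inter> H \<subseteq> K" "(p ` K, p ` H) \<in> R"
  using assms by (simp_all add: pullback_def)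

lemma subgroup_preimage:
  assumes "subgroup K Q" shows "subgroup (pre K) G"
proof -
  interpret K: subgroup K Q by fact
  show ?thesis by unfold_locales auto
qed

lemma image_preimage: "subgroup K Q \<Longrightarrow> p ` pre K = K"
  using surj subgroup.subset[of K Q] by (auto simp: image_iff set_eq_iff) (metis imageE subsetD)

text \<open>If \<open>p x = p k\<close> with \<open>k \<in> K\<close>, then \<open>x k\<^sup>-\<^sup>1\<close> lies in \<open>ker p \<inter> H \<subseteq> K\<close>.\<close>

lemma mem_if_same_image:
  assumes "subgroup K G" "subgroup H G" "K \<subseteq> H" "kernel G Q p \<inter> H \<subseteq> K"
    and "x \<in> H" "p x \<in> p ` K"
  shows "x \<in> K"
proof -
  obtain k where k: "p x = p k" "k \<in> K" using assms(6) by (rule imageE)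
  have "k \<in> H" using assms(3) k(2) by (rule subsetD)
  have c: "x \<in> carrier G" "k \<in> carrier G"
    using subgroup.mem_carrier[OF assms(2)] assms(5) \<open>k \<in> H\<close> by simp_all
  have "x \<otimes> inv k \<in> kernel G Q p" using c k by (simp add: kernel_def)
  moreover have "x \<otimes> inv k \<in> H"
    using subgroup.m_closed[OF assms(2)] subgroup.m_inv_closed[OF assms(2)] assms(5) \<open>k \<in> H\<close>
    by simp
  ultimately have "x \<otimes> inv k \<in> K" using subsetD[OF assms(4), OF IntI] by simp
  then have "x \<otimes> inv k \<otimes> k \<in> K" using k(2) by (rule subgroup.m_closed[OF assms(1)])
  then show ?thesis using c by (simp add: G.m_assoc)
qed

lemma image_Int:
  assumes "subgroup K G" "subgroup H G" "K \<subseteq> H" "kernel G Q p \<inter> H \<subseteq> K" "L \<subseteq> H"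
  shows "p ` (K \<inter> L) = p ` K \<inter> p ` L"
proof
  show "p ` K \<inter> p ` L \<subseteq> p ` (K \<inter> L)"
  proof
    fix y assume "y \<in> p ` K \<inter> p ` L"
    then have y: "y \<in> p ` K" "y \<in> p ` L" by simp_all
    obtain x where x: "y = p x" "x \<in> L" using y(2) by (rule imageE)
    have "x \<in> K"
      using mem_if_same_image[OF assms(1-4) subsetD[OF assms(5) x(2)]] y(1) x(1) by simp
    then show "y \<in> p ` (K \<inter> L)" using x by simp
  qed
qed (rule image_Int_subset)

lemma preimage_image_Int:
  assumes "subgroup K G" "subgroup H G" "K \<subseteq> H" "kernel G Q p \<inter> H \<subseteq> K"
  shows "pre (p ` K) \<inter> H = K"
proof
  show "pre (p ` K) \<inter> H \<subseteq> K" using mem_if_same_image[OF assms] by blast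
  show "K \<subseteq> pre (p ` K) \<inter> H" using assms(3) subgroup.subset[OF assms(1)] by auto
qed

lemma image_conjugate:
  assumes "g \<in> carrier G" "A \<subseteq> carrier G"
  shows "p ` (g <#\<^bsub>G\<^esub> A #>\<^bsub>G\<^esub> inv\<^bsub>G\<^esub> g) = p g <#\<^bsub>Q\<^esub> p ` A #>\<^bsub>Q\<^esub> inv\<^bsub>Q\<^esub> p g"
proof -
  have "p (g \<otimes> x \<otimes> inv g) = p g \<otimes>\<^bsub>Q\<^esub> p x \<otimes>\<^bsub>Q\<^esub> inv\<^bsub>Q\<^esub> p g" if "x \<in> A" for x
    using subsetD[OF assms(2) that] assms(1) by simp
  then show ?thesis unfolding conjugate_eq_image image_image by (rule image_cong[OF refl])
qed

lemma preimage_conjugate: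
  assumes "g \<in> carrier G" "A \<subseteq> carrier Q"
  shows "pre (p g <#\<^bsub>Q\<^esub> A #>\<^bsub>Q\<^esub> inv\<^bsub>Q\<^esub> p g) = g <#\<^bsub>G\<^esub> pre A #>\<^bsub>G\<^esub> inv\<^bsub>G\<^esub> g"
proof (intro equalityI subsetI)
  fix x assume "x \<in> pre (p g <#\<^bsub>Q\<^esub> A #>\<^bsub>Q\<^esub> inv\<^bsub>Q\<^esub> p g)"
  then obtain a where x: "x \<in> carrier G" and a: "a \<in> A" "p x = p g \<otimes>\<^bsub>Q\<^esub> a \<otimes>\<^bsub>Q\<^esub> inv\<^bsub>Q\<^esub> p g"
    by (auto simp: conjugate_eq_image)
  have "a \<in> carrier Q" using a assms by blast
  then have "p (inv g \<otimes> x \<otimes> g) = a"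
    using x a assms by (simp add: H.conjugate_cancel)
  moreover have "x = g \<otimes> (inv g \<otimes> x \<otimes> g) \<otimes> inv g"
    using x assms by (simp add: G.conjugate_cancel)
  moreover have "inv g \<otimes> x \<otimes> g \<in> carrier G" using x assms by simp
  ultimately show "x \<in> g <# pre A #> inv g"
    using a(1) unfolding conjugate_eq_image by (intro image_eqI[where x = "inv g \<otimes> x \<otimes> g"]) simp_all
next
  fix x assume "x \<in> g <# pre A #> inv g"
  then obtain y where "y \<in> pre A" "x = g \<otimes> y \<otimes> inv g" by (auto simp: conjugate_eq_image)
  then show "x \<in> pre (p g <#\<^bsub>Q\<^esub> A #>\<^bsub>Q\<^esub> inv\<^bsub>Q\<^esub> p g)"
    using assms by (simp add: conjugate_eq_image)
qed

lemma transfer_system_pullback: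
  assumes R: "transfer_system Q R"
  shows "transfer_system G (pullback R)"
  unfolding transfer_system_def
proof (intro conjI allI impI ballI)
  fix K H assume KH: "(K, H) \<in> pullback R"
  show "subgroup K G" "subgroup H G" "K \<subseteq> H" using pullbackD[OF KH] by simp_all
next
  fix H assume H: "subgroup H G"
  show "(H, H) \<in> pullback R"
    using transfer_system_refl[OF R subgroup_img_is_subgroup[OF H]]
    by (intro pullbackI H) simp_all
next
  fix K H g assume g: "g \<in> carrier G" and KH: "(K, H) \<in> pullback R"
  note KH' = pullbackD[OF KH]
  note c = KH'(1,2)[THEN subgroup.subset]
  show "(g <# K #> inv g, g <# H #> inv g) \<in> pullback R"
  proof (rule pullbackI)
    show "subgroup (g <# K #> inv g) G" "subgroup (g <# H #> inv g) G"
      using KH' g conjugate_subgroup[OF G.group_axioms] by simp_all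
    show "g <# K #> inv g \<subseteq> g <# H #> inv g"
      unfolding conjugate_eq_image by (rule image_mono[OF KH'(3)])
    show "(p ` (g <# K #> inv g), p ` (g <# H #> inv g)) \<in> R"
      using transfer_system_conj[OF R KH'(5), of "p g"] g c by (simp add: image_conjugate)
    show "kernel G Q p \<inter> (g <# H #> inv g) \<subseteq> g <# K #> inv g"
    proof clarify
      fix x assume x: "x \<in> kernel G Q p" "x \<in> g <# H #> inv g"
      then obtain y where y: "y \<in> H" "x = g \<otimes> y \<otimes> inv g" by (auto simp: conjugate_eq_image)
      have yc: "y \<in> carrier G" using y c by blast
      have "y = inv g \<otimes> x \<otimes> g"
        using y(2) yc g by (simp add: G.conjugate_cancel)
      then have "p y = \<one>\<^bsub>Q\<^esub>" using x(1) g by (simp add: kernel_def)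
      then have "y \<in> K" using yc y(1) KH'(4) by (auto simp: kernel_def)
      then show "x \<in> g <# K #> inv g" unfolding conjugate_eq_image y(2) by (rule imageI)
    qed
  qed
next
  fix K H L assume KH: "(K, H) \<in> pullback R" and L: "subgroup L G" "L \<subseteq> H"
  note KH' = pullbackD[OF KH]
  show "(K \<inter> L, L) \<in> pullback R"
  proof (rule pullbackI)
    show "subgroup (K \<inter> L) G" using KH'(1) L(1) by (rule G.subgroups_Inter_pair)
    show "kernel G Q p \<inter> L \<subseteq> K \<inter> L" using KH'(4) L(2) by blast
    show "(p ` (K \<inter> L), p ` L) \<in> R"
      unfolding image_Int[OF KH'(1-4) L(2)]
      by (rule transfer_system_restrict[OF R KH'(5) subgroup_img_is_subgroup[OF L(1)]
            image_mono[OF L(2)]])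
  qed (use L in auto)
next
  fix L K H assume LK: "(L, K) \<in> pullback R" and KH: "(K, H) \<in> pullback R"
  note LK' = pullbackD[OF LK] and KH' = pullbackD[OF KH]
  show "(L, H) \<in> pullback R"
  proof (rule pullbackI)
    show "L \<subseteq> H" using LK'(3) KH'(3) by (rule subset_trans)
    show "kernel G Q p \<inter> H \<subseteq> L" using LK'(4) KH'(4) by blast
    show "(p ` L, p ` H) \<in> R" using transfer_system_trans[OF R LK'(5) KH'(5)] .
  qed (fact LK'(1) KH'(2))+
qed

lemma preimage_relation_subset_pullback:
  assumes "transfer_system Q R"
  shows "preimage_relation G p R \<subseteq> pullback R"
proof clarify
  fix K H assume "(K, H) \<in> preimage_relation G p R"
  then obtain K' H' where *: "K = pre K'" "H = pre H'" "(K', H') \<in> R"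
    by (auto simp: preimage_relation_def)
  note s = transfer_system_subgroup[OF assms *(3)]
  have "kernel G Q p \<inter> H \<subseteq> K"
    using subgroup.one_closed[OF s(1)] by (auto simp: *(1) kernel_def)
  moreover have "K \<subseteq> H" using s(3) by (auto simp: *(1,2))
  ultimately show "(K, H) \<in> pullback R"
    using s *(3) by (simp add: pullback_def *(1,2) image_preimage subgroup_preimage)
qed

lemma generated_preimage_relation:
  assumes R: "transfer_system Q R"
  shows "generated_transfer_system G (preimage_relation G p R) = pullback R"
proof (rule generated_transfer_system_eqI)
  fix T assume T: "transfer_system G T" "preimage_relation G p R \<subseteq> T"
  show "pullback R \<subseteq> T"
  proof clarify
    fix K H assume KH: "(K, H) \<in> pullback R"
    then have "(pre (p ` K), pre (p ` H)) \<in> T"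
      using T(2) by (auto simp: pullback_def preimage_relation_def)
    moreover have "subgroup H G" "H \<subseteq> pre (p ` H)"
      using KH by (auto simp: pullback_def dest: subgroup.subset)
    ultimately have "(pre (p ` K) \<inter> H, H) \<in> T"
      using transfer_system_restrict[OF T(1)] by blast
    moreover have "pre (p ` K) \<inter> H = K"
      using KH by (intro preimage_image_Int) (auto simp: pullback_def)
    ultimately show "(K, H) \<in> T" by simp
  qed
qed (use assms transfer_system_pullback preimage_relation_subset_pullback in auto)

section \<open>Disklike, saturated and compatible systems\<close>

text \<open>
  Since this system contains \<open>B\<close> whenever \<open>T\<close> contains \<open>preimage_relation G p B\<close>, it contains the
  system that \<open>B\<close> generates. This is how generation on \<open>Q\<close> is transferred to \<open>G\<close>.
\<close>

lemma transfer_system_pushforward: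
  assumes T: "transfer_system G T"
  shows "transfer_system Q {(K, H). subgroup K Q \<and> subgroup H Q \<and> (pre K, pre H) \<in> T}"
    (is "transfer_system Q ?S")
  unfolding transfer_system_def
proof (intro conjI allI impI ballI)
  fix K H assume KH: "(K, H) \<in> ?S"
  then show "subgroup K Q" "subgroup H Q" by auto
  have "p ` pre K \<subseteq> p ` pre H"
    using KH transfer_system_subgroup(3)[OF T] by blast
  then show "K \<subseteq> H" using KH image_preimage by simp
next
  fix H assume "subgroup H Q"
  then show "(H, H) \<in> ?S" using transfer_system_refl[OF T subgroup_preimage] by simp
next
  fix K H q assume q: "q \<in> carrier Q" and KH: "(K, H) \<in> ?S"
  obtain g where g: "g \<in> carrier G" "q = p g" using q surj by blast
  have c: "K \<subseteq> carrier Q" "H \<subseteq> carrier Q" using KH by (auto dest: subgroup.subset)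
  show "(q <#\<^bsub>Q\<^esub> K #>\<^bsub>Q\<^esub> inv\<^bsub>Q\<^esub> q, q <#\<^bsub>Q\<^esub> H #>\<^bsub>Q\<^esub> inv\<^bsub>Q\<^esub> q) \<in> ?S"
    using KH q transfer_system_conj[OF T _ g(1)] conjugate_subgroup[OF H.group_axioms]
    unfolding g(2) by (simp add: preimage_conjugate[OF g(1)] c)
next
  fix K H L assume KH: "(K, H) \<in> ?S" and L: "subgroup L Q" "L \<subseteq> H"
  have "(pre K \<inter> pre L, pre L) \<in> T"
    using KH L subgroup_preimage by (intro transfer_system_restrict[OF T]) auto
  moreover have "pre K \<inter> pre L = pre (K \<inter> L)" by blast
  ultimately show "(K \<inter> L, L) \<in> ?S"
    using KH L H.subgroups_Inter_pair by auto
next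
  fix L K H assume "(L, K) \<in> ?S" "(K, H) \<in> ?S"
  then show "(L, H) \<in> ?S" using transfer_system_trans[OF T] by blast
qed

lemma disklike_pullback:
  assumes "disklike Q R"
  shows "disklike G (pullback R)"
proof -
  obtain B where R: "transfer_system Q R" and B: "B \<subseteq> {K. subgroup K Q} \<times> {carrier Q}"
    and gen: "R = generated_transfer_system Q B"
    using assms by (auto simp: disklike_def)
  have "generated_transfer_system G (preimage_relation G p B) = pullback R"
  proof (rule generated_transfer_system_eqI)
    have "B \<subseteq> R" by (auto simp: gen generated_transfer_system_def)
    then show "preimage_relation G p B \<subseteq> pullback R"
      using preimage_relation_subset_pullback[OF R] by (auto simp: preimage_relation_def)
  next
    fix T assume T: "transfer_system G T" "preimage_relation G p B \<subseteq> T"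
    have "R \<subseteq> {(K, H). subgroup K Q \<and> subgroup H Q \<and> (pre K, pre H) \<in> T}"
      unfolding gen using B T(2) H.subgroup_self
      by (intro generated_transfer_system_least transfer_system_pushforward[OF T(1)])
        (auto simp: preimage_relation_def)
    then have "preimage_relation G p R \<subseteq> T" by (auto simp: preimage_relation_def)
    from generated_transfer_system_least[OF T(1) this] show "pullback R \<subseteq> T"
      by (simp add: generated_preimage_relation[OF R])
  qed (rule transfer_system_pullback[OF R])
  moreover have "pre (carrier Q) = carrier G" by auto
  then have "preimage_relation G p B \<subseteq> {K. subgroup K G} \<times> {carrier G}"
    using B subgroup_preimage by (auto simp: preimage_relation_def)
  ultimately show ?thesis
    using transfer_system_pullback[OF R] unfolding disklike_def by metis
qed

lemma saturated_pullback:
  assumes "saturated Q R"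
  shows "saturated G (pullback R)"
proof -
  have R: "transfer_system Q R" using assms by (simp add: saturated_def)
  have "(K, H) \<in> pullback R"
    if LH: "(L, H) \<in> pullback R" and K: "subgroup K G" "L \<subseteq> K" "K \<subseteq> H" for L K H
  proof -
    have "(p ` L, p ` H) \<in> R" using LH by (simp add: pullback_def)
    then have "(p ` K, p ` H) \<in> R"
      using assms subgroup_img_is_subgroup[OF K(1)] image_mono[OF K(2), of p]
        image_mono[OF K(3), of p] by (auto simp only: saturated_def)
    moreover have "kernel G Q p \<inter> H \<subseteq> K" using LH K(2) by (auto simp: pullback_def)
    ultimately show ?thesis using LH K by (simp add: pullback_def)
  qed
  then show ?thesis using transfer_system_pullback[OF R] unfolding saturated_def by blast
qed

text \<open>
  Let \<open>K \<rightarrow> H\<close> be in the pullback of \<open>M\<close> and \<open>K \<inter> J \<rightarrow> K\<close> in that of \<open>R\<close>. The two kernel conditions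
  chain to \<open>ker p \<inter> H \<subseteq> J\<close>, and since \<open>p (K \<inter> J) = p K \<inter> p J\<close> the images are a case of the
  compatibility of \<open>R\<close> and \<open>M\<close>.
\<close>

lemma compatible_pullback:
  assumes "compatible Q R M"
  shows "compatible G (pullback R) (pullback M)"
proof -
  have R: "transfer_system Q R" and M: "transfer_system Q M" and "M \<subseteq> R"
    using assms by (auto simp: compatible_def)
  have "(J, H) \<in> pullback R"
    if KH: "(K, H) \<in> pullback M" and J: "subgroup J G" "J \<subseteq> H"
      and KJ: "(K \<inter> J, K) \<in> pullback R" for K J H
  proof -
    have "p ` (K \<inter> J) = p ` K \<inter> p ` J"
      using KH J by (intro image_Int[of K H]) (auto simp: pullback_def)
    moreover have "(p ` K, p ` H) \<in> M" "(p ` (K \<inter> J), p ` K) \<in> R"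
      using KH KJ by (simp_all add: pullback_def)
    ultimately have "(p ` J, p ` H) \<in> R"
      using assms subgroup_img_is_subgroup[OF J(1)] image_mono[OF J(2), of p]
      by (simp add: compatible_def)
    moreover have "kernel G Q p \<inter> H \<subseteq> J" using KH KJ by (auto simp: pullback_def)
    ultimately show ?thesis using KH J by (simp add: pullback_def)
  qed
  then show ?thesis
    using \<open>M \<subseteq> R\<close> transfer_system_pullback[OF R] transfer_system_pullback[OF M]
    unfolding compatible_def by (auto simp: pullback_def)
qed

section \<open>Maximal compatibility\<close>

lemma image_preimage_Int:
  assumes "J \<subseteq> p ` H" "H \<subseteq> carrier G"
  shows "p ` (pre J \<inter> H) = J"
proof
  show "p ` (pre J \<inter> H) \<subseteq> J" by auto
  show "J \<subseteq> p ` (pre J \<inter> H)"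
  proof
    fix y assume y: "y \<in> J"
    obtain x where x: "y = p x" "x \<in> H" using subsetD[OF assms(1) y] by (rule imageE)
    then have "x \<in> pre J \<inter> H" using y assms(2) by auto
    then show "y \<in> p ` (pre J \<inter> H)" unfolding x(1) by (rule imageI)
  qed
qed

text \<open>
  Subgroups \<open>J \<subseteq> p H\<close> are lifted to \<open>p\<^sup>-\<^sup>1 J \<inter> H\<close>, a subgroup of \<open>H\<close> with image \<open>J\<close> that contains
  \<open>ker p \<inter> H\<close>. Restriction and compatibility on \<open>Q\<close> thus reduce to the same properties of \<open>T\<close>, as \<open>p\<close>
  preserves the intersections with the source of a transfer of \<open>T\<close>. The closure supplies transitivity,
  which the image alone may lack.
\<close>

lemma compatible_image:
  assumes R: "transfer_system Q R" and T: "compatible G (pullback R) T"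
  shows "compatible Q R ((map_prod ((`) p) ((`) p) ` T)\<^sup>+)" (is "compatible Q R (?S\<^sup>+)")
proof -
  have Tt: "transfer_system G T" and TR: "T \<subseteq> pullback R" using T by (auto simp: compatible_def)
  note T_sub = pullbackD[OF subsetD[OF TR]]
  have S_I: "(p ` K, p ` H) \<in> ?S" if "(K, H) \<in> T" for K H
    using imageI[OF that, of "map_prod ((`) p) ((`) p)"] by simp
  have S_E: thesis if "(K, H) \<in> ?S"
    and "\<And>K' H'. (K', H') \<in> T \<Longrightarrow> K = p ` K' \<Longrightarrow> H = p ` H' \<Longrightarrow> thesis" for K H thesis
    using that(1)
  proof (rule imageE)
    fix z assume "(K, H) = map_prod ((`) p) ((`) p) z" "z \<in> T"
    then show thesis by (intro that(2)[of "fst z" "snd z"]) (simp_all add: map_prod_def split_beta)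
  qed
  have lift: "subgroup (pre J \<inter> H) G" "p ` (pre J \<inter> H) = J"
    if "subgroup J Q" "subgroup H G" "J \<subseteq> p ` H" for J H
    using G.subgroups_Inter_pair[OF subgroup_preimage[OF that(1)] that(2)]
      image_preimage_Int[OF that(3) subgroup.subset[OF that(2)]] by simp_all
  have S: "transfer_system Q (?S\<^sup>+)"
  proof (rule transfer_system_trancl[OF H.group_axioms])
    fix K H assume "(K, H) \<in> ?S"
    then obtain K' H' where KH: "(K', H') \<in> T" "K = p ` K'" "H = p ` H'" by (rule S_E)
    show "subgroup K Q \<and> subgroup H Q \<and> K \<subseteq> H"
      using T_sub(1,2)[OF KH(1), THEN subgroup_img_is_subgroup] image_mono[OF T_sub(3)[OF KH(1)]]
      unfolding KH(2,3) by (intro conjI)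
  next
    fix H assume H: "subgroup H Q"
    then show "(H, H) \<in> ?S"
      using S_I[OF transfer_system_refl[OF Tt subgroup_preimage[OF H]]]
      by (simp only: image_preimage)
  next
    fix K H q assume "(K, H) \<in> ?S" and q: "q \<in> carrier Q"
    from this(1) obtain K' H' where KH: "(K', H') \<in> T" "K = p ` K'" "H = p ` H'" by (rule S_E)
    obtain g where g: "q = p g" "g \<in> carrier G" using q unfolding surj[symmetric] by (rule imageE)
    show "(q <#\<^bsub>Q\<^esub> K #>\<^bsub>Q\<^esub> inv\<^bsub>Q\<^esub> q, q <#\<^bsub>Q\<^esub> H #>\<^bsub>Q\<^esub> inv\<^bsub>Q\<^esub> q) \<in> ?S"
      using S_I[OF transfer_system_conj[OF Tt KH(1) g(2)]]
        T_sub(1,2)[OF KH(1), THEN subgroup.subset]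
      unfolding KH(2,3) g(1) by (simp only: image_conjugate[OF g(2)])
  next
    fix K H L assume "(K, H) \<in> ?S" and L: "subgroup L Q" "L \<subseteq> H"
    from this(1) obtain K' H' where KH: "(K', H') \<in> T" "K = p ` K'" "H = p ` H'" by (rule S_E)
    note s = T_sub[OF KH(1)]
    let ?L = "pre L \<inter> H'"
    note l = lift[OF L(1) s(2) L(2)[unfolded KH(3)]]
    have "(K' \<inter> ?L, ?L) \<in> T" using transfer_system_restrict[OF Tt KH(1) l(1)] by simp
    moreover have "p ` (K' \<inter> ?L) = K \<inter> L"
      using image_Int[OF s(1-4) Int_lower2[of "pre L"]] unfolding l(2) KH(2) .
    ultimately show "(K \<inter> L, L) \<in> ?S" using S_I[of "K' \<inter> ?L" ?L] l(2) by simp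
  qed
  show ?thesis
  proof (rule compatible_trancl[OF H.group_axioms R S])
    show "?S \<subseteq> R"
    proof (rule subrelI)
      fix K H assume "(K, H) \<in> ?S"
      then obtain K' H' where KH: "(K', H') \<in> T" "K = p ` K'" "H = p ` H'" by (rule S_E)
      show "(K, H) \<in> R" using T_sub(5)[OF KH(1)] unfolding KH(2,3) .
    qed
  next
    fix K J H assume "(K, H) \<in> ?S" and J: "subgroup J Q" "J \<subseteq> H" "(K \<inter> J, K) \<in> R"
    from this(1) obtain K' H' where KH: "(K', H') \<in> T" "K = p ` K'" "H = p ` H'" by (rule S_E)
    note s = T_sub[OF KH(1)]
    let ?J = "pre J \<inter> H'"
    note l = lift[OF J(1) s(2) J(2)[unfolded KH(3)]]
    have "p ` (K' \<inter> ?J) = K \<inter> J"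
      using image_Int[OF s(1-4) Int_lower2[of "pre J"]] unfolding l(2) KH(2) .
    moreover have "kernel G Q p \<inter> K' \<subseteq> K' \<inter> ?J"
    proof
      fix x assume "x \<in> kernel G Q p \<inter> K'"
      then show "x \<in> K' \<inter> ?J"
        using subsetD[OF s(3)] subgroup.one_closed[OF J(1)] by (simp add: kernel_def)
    qed
    ultimately have "(K' \<inter> ?J, K') \<in> pullback R"
      using G.subgroups_Inter_pair[OF s(1) l(1)] s(1) J(3) KH(2) by (intro pullbackI) simp_all
    then have "(?J, H') \<in> pullback R"
      using compatibleD[OF T KH(1) l(1) Int_lower2] by simp
    then have "(p ` ?J, p ` H') \<in> R" by (rule pullbackD(5))
    then show "(J, H) \<in> R" unfolding l(2) KH(3) .
  qed
qed

lemma maximally_compatible_pullback: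
  assumes "maximally_compatible Q R M"
  shows "maximally_compatible G (pullback R) (pullback M)"
proof -
  have comp: "compatible Q R M" and M: "M = max_compatible Q R"
    using assms by (auto simp: maximally_compatible_def)
  have R: "transfer_system Q R" using comp by (simp add: compatible_def)
  note PR = transfer_system_pullback[OF R]
  let ?T = "max_compatible G (pullback R)"
  have T: "compatible G (pullback R) ?T"
    using compatible_max_compatible[OF G.group_axioms PR] .
  have image_M: "(map_prod ((`) p) ((`) p) ` ?T)\<^sup>+ \<subseteq> M"
    unfolding M
    by (rule max_compatible_greatest[OF H.group_axioms R compatible_image[OF R T]])
  have "?T \<subseteq> pullback M"
  proof clarify
    fix K H assume KH: "(K, H) \<in> ?T"
    then have "(K, H) \<in> pullback R" using T by (auto simp: compatible_def)
    note KH' = pullbackD[OF this]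
    have "(p ` K, p ` H) \<in> map_prod ((`) p) ((`) p) ` ?T"
      using imageI[OF KH, of "map_prod ((`) p) ((`) p)"] by simp
    then have "(p ` K, p ` H) \<in> M" by (rule subsetD[OF image_M r_into_trancl])
    with KH' show "(K, H) \<in> pullback M" by (intro pullbackI)
  qed
  moreover have "pullback M \<subseteq> ?T"
    using max_compatible_greatest[OF G.group_axioms PR compatible_pullback[OF comp]] .
  ultimately show ?thesis
    using compatible_pullback[OF comp] by (simp add: maximally_compatible_def)
qed

end

section \<open>Inflation from a quotient group\<close>

lemma inflation_eq_generated:
  "inflation G N R = generated_transfer_system G (preimage_relation G (\<lambda>g. N #>\<^bsub>G\<^esub> g) R)"
  by (simp add: inflation_def preimage_relation_def quotient_preimage_def)

theorem theorem1p2: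
  fixes G :: "('a, 'b) monoid_scheme" and N :: "'a set"
    and \<O> \<O>\<^sub>m :: "('a set set \<times> 'a set set) set"
  assumes "group G" and "finite (carrier G)" and "N \<lhd> G"
    and "transfer_system (G Mod N) \<O>" and "transfer_system (G Mod N) \<O>\<^sub>m"
  shows "(disklike (G Mod N) \<O> \<longrightarrow> disklike G (inflation G N \<O>)) \<and>
         (saturated (G Mod N) \<O> \<longrightarrow> saturated G (inflation G N \<O>)) \<and>
         (compatible (G Mod N) \<O> \<O>\<^sub>m \<longrightarrow>
            compatible G (inflation G N \<O>) (inflation G N \<O>\<^sub>m)) \<and>
         (maximally_compatible (G Mod N) \<O> \<O>\<^sub>m \<longrightarrow>
            maximally_compatible G (inflation G N \<O>) (inflation G N \<O>\<^sub>m))"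
proof -
  interpret N: normal N G by fact
  interpret group_epi G "G Mod N" "\<lambda>g. N #>\<^bsub>G\<^esub> g"
  proof (intro group_epi.intro group_hom.intro group_hom_axioms.intro group_epi_axioms.intro)
    show "(\<lambda>g. N #>\<^bsub>G\<^esub> g) ` carrier G = carrier (G Mod N)"
      by (auto simp: FactGroup_def RCOSETS_def)
  qed (use assms(1) N.factorgroup_is_group N.r_coset_hom_Mod in auto)
  have infl: "inflation G N \<O> = pullback \<O>" "inflation G N \<O>\<^sub>m = pullback \<O>\<^sub>m"
    using assms by (simp_all add: inflation_eq_generated generated_preimage_relation)
  show ?thesis
    unfolding infl
    using disklike_pullback saturated_pullback compatible_pullback maximally_compatible_pullback
    by blast
qed

end
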